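(* Let $d\ge1$, $r<N$, $L^1,\ldots,L^d,G^1,\ldots,G^r\in C^1([a,b]\times\mathbb{R}^{2N};\mathbb{R})$ with $G^1,\ldots,G^r$ independent, $\mathbf{y}^a,\mathbf{y}^b\in\mathbb{R}^N$, and let $\mathcal{E}$ be the set of all $\mathbf{y}\in\mathbf{D}$ with $\mathbf{y}(a)=\mathbf{y}^a$, $\mathbf{y}(b)=\mathbf{y}^b$ and $G^j[\mathbf{y}]^{\alpha,\beta}_{\gamma}(x)\le0$ for $x\in[a,b]$, $j=1,\ldots,r$. Put $\mathcal{J}^i(\mathbf{y})=\int_a^bL^i[\mathbf{y}]^{\alpha,\beta}_{\gamma}(x)\,dx$. Let $w_1,\ldots,w_d\ge0$ with $\sum_{i=1}^dw_i=1$ and consider the weighting problem $$\sum_{i=1}^dw_i\,\mathcal{J}^i(\mathbf{y})\longrightarrow\min\quad\text{subject to }\mathbf{y}\in\mathcal{E}.$$ (1) If $w_i>0$ for all $i=1,\ldots,d$, then every solution of the weighting problem is a Pareto optimal solution of the multiobjective problem $(\mathcal{J}^1(\mathbf{y}),\ldots,\mathcal{J}^d(\mathbf{y}))\to\min$ subject to $\mathbf{y}\in\mathcal{E}$. (2) If the weighting problem has a unique solution, then this solution is a Pareto optimal solution of the multiobjective problem.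
   Context: Let $a<b$, $N,r\in\mathbb{N}$, and $\alpha,\beta,\gamma\in\mathbb{R}^N$ with $\alpha_i,\beta_i\in(0,1)$, $\gamma_i\in[0,1]$. For scalar $\alpha\in(0,1)$, the left and right Riemann--Liouville fractional integrals are ${}_aI_x^{\alpha}f(x)=\frac{1}{\Gamma(\alpha)}\int_a^x(x-t)^{\alpha-1}f(t)\,dt$ and ${}_xI_b^{\alpha}f(x)=\frac{1}{\Gamma(\alpha)}\int_x^b(t-x)^{\alpha-1}f(t)\,dt$. For $f\in AC([a,b])$ (absolutely continuous), the left and right Caputo derivatives are ${}^C_aD_x^{\alpha}f={}_aI_x^{1-\alpha}f'$ and ${}^C_xD_b^{\alpha}f=-\,{}_xI_b^{1-\alpha}f'$. For scalars $\alpha,\beta\in(0,1)$, $\gamma\in[0,1]$, ${}^CD^{\alpha,\beta}_{\gamma}=\gamma\,{}^C_aD_x^{\alpha}+(1-\gamma)\,{}^C_xD_b^{\beta}$. For vector parameters and $\mathbf{y}=(y_1,\ldots,y_N)$, ${}^CD^{\alpha,\beta}_{\gamma}\mathbf{y}=[{}^CD^{\alpha_1,\beta_1}_{\gamma_1}y_1,\ldots,{}^CD^{\alpha_N,\beta_N}_{\gamma_N}y_N]$. $\mathbf{D}$ is the set of $\mathbf{y}:[a,b]\to\mathbb{R}^N$ with components in $AC([a,b])$ such that ${}^CD^{\alpha,\beta}_{\gamma}\mathbf{y}$ exists and is continuous on $[a,b]$. $K[\mathbf{y}]^{\alpha,\beta}_{\gamma}(x)$ denotes $K$ evaluated at $(x,\mathbf{y}(x),{}^CD^{\alpha,\beta}_{\gamma}\mathbf{y}(x))$.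 Independence of $G^1,\ldots,G^r$: writing their arguments as $(p_1,\ldots,p_{2N+1})$, there is a nonvanishing Jacobian determinant of order $r$ of $(G^1,\ldots,G^r)$ with respect to some $r$ of the variables $p_{N+2},\ldots,p_{2N+1}$. $\bar{\mathbf{y}}\in\mathcal{E}$ is a Pareto optimal solution if there is no $\mathbf{y}\in\mathcal{E}$ with $\mathcal{J}^i(\mathbf{y})\le\mathcal{J}^i(\bar{\mathbf{y}})$ for all $i\in\{1,\ldots,d\}$ and $\mathcal{J}^i(\mathbf{y})<\mathcal{J}^i(\bar{\mathbf{y}})$ for some $i\in\{1,\ldots,d\}$. *)

theory Defs
  imports "HOL-Analysis.Analysis" "Jordan_Normal_Form.Determinant"
begin

no_notation Matrix.vec_index (infixl "$" 100)

definition absolutely_continuous_on_interval :: "real \<Rightarrow> real \<Rightarrow> (real \<Rightarrow> real) \<Rightarrow> bool" where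
  "absolutely_continuous_on_interval a b f \<longleftrightarrow>
     (\<forall>\<epsilon>>0. \<exists>\<delta>>0. \<forall>I :: (real \<times> real) set.
        finite I \<and> (\<forall>(u, v)\<in>I. a \<le> u \<and> u < v \<and> v \<le> b) \<and>
        pairwise (\<lambda>(u, v) (u', v'). {u<..<v} \<inter> {u'<..<v'} = {}) I \<and>
        (\<Sum>(u, v)\<in>I. v - u) < \<delta> \<longrightarrow>
        (\<Sum>(u, v)\<in>I. \<bar>f v - f u\<bar>) < \<epsilon>)"

text \<open>Lebesgue integrals are taken with respect to the completed measure, so that the values
  of the integrand on a null set (in particular \<^term>\<open>deriv f\<close> at the points where \<^term>\<open>f\<close> is
  not differentiable, and the kernel at its singularity) play no role.  The integral
  defining a fractional integral at \<^term>\<open>x\<close> need not converge, and HOL functions are total;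
  convergence at \<^term>\<open>x\<close> is recorded by the predicates with suffix \<open>exists\<close>.\<close>

definition rl_left :: "real \<Rightarrow> real \<Rightarrow> (real \<Rightarrow> real) \<Rightarrow> real \<Rightarrow> real" where
  "rl_left a \<alpha> f x = 1 / Gamma \<alpha> * (LINT t:{a..x}|lebesgue. (x - t) powr (\<alpha> - 1) * f t)"

definition rl_left_exists :: "real \<Rightarrow> real \<Rightarrow> (real \<Rightarrow> real) \<Rightarrow> real \<Rightarrow> bool" where
  "rl_left_exists a \<alpha> f x \<longleftrightarrow> set_integrable lebesgue {a..x} (\<lambda>t. (x - t) powr (\<alpha> - 1) * f t)"

definition rl_right :: "real \<Rightarrow> real \<Rightarrow> (real \<Rightarrow> real) \<Rightarrow> real \<Rightarrow> real" where
  "rl_right b \<alpha> f x = 1 / Gamma \<alpha> * (LINT t:{x..b}|lebesgue. (t - x) powr (\<alpha> - 1) * f t)"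

definition rl_right_exists :: "real \<Rightarrow> real \<Rightarrow> (real \<Rightarrow> real) \<Rightarrow> real \<Rightarrow> bool" where
  "rl_right_exists b \<alpha> f x \<longleftrightarrow> set_integrable lebesgue {x..b} (\<lambda>t. (t - x) powr (\<alpha> - 1) * f t)"

definition caputo_left :: "real \<Rightarrow> real \<Rightarrow> (real \<Rightarrow> real) \<Rightarrow> real \<Rightarrow> real" where
  "caputo_left a \<alpha> f = rl_left a (1 - \<alpha>) (deriv f)"

definition caputo_right :: "real \<Rightarrow> real \<Rightarrow> (real \<Rightarrow> real) \<Rightarrow> real \<Rightarrow> real" where
  "caputo_right b \<beta> f x = - rl_right b (1 - \<beta>) (deriv f) x"

definition caputo :: "real \<Rightarrow> real \<Rightarrow> real \<Rightarrow> real \<Rightarrow> real \<Rightarrow> (real \<Rightarrow> real) \<Rightarrow> real \<Rightarrow> real" where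
  "caputo a b \<alpha> \<beta> \<gamma> f x = \<gamma> * caputo_left a \<alpha> f x + (1 - \<gamma>) * caputo_right b \<beta> f x"

text \<open>A one-sided derivative whose coefficient is zero is not required to exist: for \<open>\<gamma> = 1\<close>
  (resp. \<open>\<gamma> = 0\<close>) the combined derivative is the left (resp. right) Caputo derivative.\<close>

definition caputo_exists ::
    "real \<Rightarrow> real \<Rightarrow> real \<Rightarrow> real \<Rightarrow> real \<Rightarrow> (real \<Rightarrow> real) \<Rightarrow> real \<Rightarrow> bool" where
  "caputo_exists a b \<alpha> \<beta> \<gamma> f x \<longleftrightarrow>
     (\<gamma> \<noteq> 0 \<longrightarrow> rl_left_exists a (1 - \<alpha>) (deriv f) x) \<and>
     (\<gamma> \<noteq> 1 \<longrightarrow> rl_right_exists b (1 - \<beta>) (deriv f) x)"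

definition caputo_vec :: "real \<Rightarrow> real \<Rightarrow> real^'n \<Rightarrow> real^'n \<Rightarrow> real^'n \<Rightarrow>
    (real \<Rightarrow> real^'n) \<Rightarrow> real \<Rightarrow> real^'n" where
  "caputo_vec a b \<alpha> \<beta> \<gamma> y x = (\<chi> i. caputo a b (\<alpha> $ i) (\<beta> $ i) (\<gamma> $ i) (\<lambda>t. y t $ i) x)"

text \<open>Functions on \<open>[a,b]\<close> are represented by their extensional versions, so that equality of
  two elements of \<open>D_space\<close> is equality on \<open>[a,b]\<close>.\<close>

definition D_space :: "real \<Rightarrow> real \<Rightarrow> real^'n \<Rightarrow> real^'n \<Rightarrow> real^'n \<Rightarrow>
    (real \<Rightarrow> real^'n) set" where
  "D_space a b \<alpha> \<beta> \<gamma> =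
     {y \<in> extensional {a..b}.
        (\<forall>i. absolutely_continuous_on_interval a b (\<lambda>x. y x $ i)) \<and>
        (\<forall>i. \<forall>x\<in>{a..b}. caputo_exists a b (\<alpha> $ i) (\<beta> $ i) (\<gamma> $ i) (\<lambda>t. y t $ i) x) \<and>
        continuous_on {a..b} (caputo_vec a b \<alpha> \<beta> \<gamma> y)}"

definition along :: "(real \<times> (real^'n) \<times> (real^'n) \<Rightarrow> real) \<Rightarrow> real \<Rightarrow> real \<Rightarrow>
    real^'n \<Rightarrow> real^'n \<Rightarrow> real^'n \<Rightarrow> (real \<Rightarrow> real^'n) \<Rightarrow> real \<Rightarrow> real" where
  "along K a b \<alpha> \<beta> \<gamma> y x = K (x, y x, caputo_vec a b \<alpha> \<beta> \<gamma> y x)"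

text \<open>Only used on \<open>[a,b] \<times> \<real>\<^sup>2\<^sup>N\<close>, where derivatives within the set are unique.\<close>

definition C1_on :: "'a::real_normed_vector set \<Rightarrow> ('a \<Rightarrow> real) \<Rightarrow> bool" where
  "C1_on S f \<longleftrightarrow> (\<exists>f' :: 'a \<Rightarrow> 'a \<Rightarrow>\<^sub>L real.
     (\<forall>p\<in>S. (f has_derivative blinfun_apply (f' p)) (at p within S)) \<and> continuous_on S f')"

text \<open>With \<open>p = (x, u, v)\<close>, the components of \<open>v\<close> are the variables \<open>p\<^sub>N\<^sub>+\<^sub>2, \<dots>, p\<^sub>2\<^sub>N\<^sub>+\<^sub>1\<close>.\<close>

definition partial_v :: "(real \<times> (real^'n) \<times> (real^'n) \<Rightarrow> real) \<Rightarrow> 'n \<Rightarrow>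
    real \<times> (real^'n) \<times> (real^'n) \<Rightarrow> real" where
  "partial_v K k = (\<lambda>(x, u, v). deriv (\<lambda>s. K (x, u, v + s *\<^sub>R axis k 1)) 0)"

text \<open>The map \<open>\<sigma>\<close> selects the \<open>r\<close> variables, independently of the point; the resulting
  Jacobian determinant vanishes nowhere on \<open>[a,b] \<times> \<real>\<^sup>2\<^sup>N\<close>.\<close>

definition independent_constraints :: "real \<Rightarrow> real \<Rightarrow> nat \<Rightarrow>
    (nat \<Rightarrow> real \<times> (real^'n) \<times> (real^'n) \<Rightarrow> real) \<Rightarrow> bool" where
  "independent_constraints a b r G \<longleftrightarrow>
     (\<exists>\<sigma> :: nat \<Rightarrow> 'n. inj_on \<sigma> {..<r} \<and>
        (\<forall>p \<in> {a..b} \<times> UNIV.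
           Determinant.det (Matrix.mat r r (\<lambda>(j, k). partial_v (G j) (\<sigma> k) p)) \<noteq> 0))"

definition admissible :: "real \<Rightarrow> real \<Rightarrow> real^'n \<Rightarrow> real^'n \<Rightarrow> real^'n \<Rightarrow> nat \<Rightarrow>
    (nat \<Rightarrow> real \<times> (real^'n) \<times> (real^'n) \<Rightarrow> real) \<Rightarrow> real^'n \<Rightarrow> real^'n \<Rightarrow>
    (real \<Rightarrow> real^'n) set" where
  "admissible a b \<alpha> \<beta> \<gamma> r G ya yb =
     {y \<in> D_space a b \<alpha> \<beta> \<gamma>. y a = ya \<and> y b = yb \<and>
        (\<forall>j<r. \<forall>x\<in>{a..b}. along (G j) a b \<alpha> \<beta> \<gamma> y x \<le> 0)}"

definition functional :: "(real \<times> (real^'n) \<times> (real^'n) \<Rightarrow> real) \<Rightarrow> real \<Rightarrow> real \<Rightarrow>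
    real^'n \<Rightarrow> real^'n \<Rightarrow> real^'n \<Rightarrow> (real \<Rightarrow> real^'n) \<Rightarrow> real" where
  "functional K a b \<alpha> \<beta> \<gamma> y = integral {a..b} (along K a b \<alpha> \<beta> \<gamma> y)"

definition pareto_optimal :: "'a set \<Rightarrow> nat \<Rightarrow> (nat \<Rightarrow> 'a \<Rightarrow> real) \<Rightarrow> 'a \<Rightarrow> bool" where
  "pareto_optimal E d J ybar \<longleftrightarrow> ybar \<in> E \<and>
     \<not> (\<exists>y\<in>E. (\<forall>i<d. J i y \<le> J i ybar) \<and> (\<exists>i<d. J i y < J i ybar))"

end

theory Submission
  imports Defs
begin

text \<open>This is the scalarization principle of multiobjective optimization, argued for an
  arbitrary feasible set \<open>E\<close> and real objectives \<open>J i\<close>. Suppose a feasible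
  \<open>y\<close> dominated a minimizer \<open>x\<close> of the weighted sum. With positive
  weights, \<open>y\<close> would have a strictly smaller weighted sum, which is impossible
  (\<open>weighted_sum_arg_min_pareto_optimal\<close>). With nonnegative weights, \<open>y\<close>
  would at least be a minimizer too, so uniqueness excludes it
  (\<open>weighted_sum_unique_arg_min_pareto_optimal\<close>). The variational problem is the
  instance with \<open>E\<close> the admissible functions and \<open>J i\<close> the integral
  functionals.\<close>

lemma weighted_sum_arg_min_pareto_optimal:
  fixes w :: "nat \<Rightarrow> real"
  assumes pos: "\<And>i. i < d \<Longrightarrow> 0 < w i"
    and min: "is_arg_min (\<lambda>y. \<Sum>i<d. w i * J i y) (\<lambda>y. y \<in> E) x"
  shows "pareto_optimal E d J x"
proof -
  have False
    if "y \<in> E" and le: "\<forall>i<d. J i y \<le> J i x" and less: "i < d" "J i y < J i x" for y i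
  proof -
    have "(\<Sum>i<d. w i * J i y) < (\<Sum>i<d. w i * J i x)"
    proof (rule sum_strict_mono_ex1)
      show "\<forall>k\<in>{..<d}. w k * J k y \<le> w k * J k x"
        using le pos by (auto intro!: mult_left_mono less_imp_le)
      \<comment> \<open>The witness is the improved coordinate \<open>i\<close>; its positive weight
        preserves the strict inequality.\<close>
      show "\<exists>k\<in>{..<d}. w k * J k y < w k * J k x"
        using less pos by auto
    qed simp
    with min \<open>y \<in> E\<close> show False
      by (auto simp: is_arg_min_def)
  qed
  with min show ?thesis
    by (auto simp: pareto_optimal_def is_arg_min_def)
qed

text \<open>A zero weight can hide a strict improvement, so domination yields only a weak inequality
  between the weighted sums; uniqueness supplies the contradiction instead.\<close>

lemma weighted_sum_unique_arg_min_pareto_optimal: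
  fixes w :: "nat \<Rightarrow> real"
  assumes nonneg: "\<And>i. i < d \<Longrightarrow> 0 \<le> w i"
    and min: "is_arg_min (\<lambda>y. \<Sum>i<d. w i * J i y) (\<lambda>y. y \<in> E) x"
    and unique: "\<And>z. is_arg_min (\<lambda>y. \<Sum>i<d. w i * J i y) (\<lambda>y. y \<in> E) z \<Longrightarrow> z = x"
  shows "pareto_optimal E d J x"
proof -
  have False
    if "y \<in> E" and le: "\<forall>i<d. J i y \<le> J i x" and less: "i < d" "J i y < J i x" for y i
  proof -
    have "(\<Sum>i<d. w i * J i y) \<le> (\<Sum>i<d. w i * J i x)"
      using le nonneg by (intro sum_mono mult_left_mono) auto
    \<comment> \<open>In a linear order, being an arg min means lying below every feasible value, so
      \<open>y\<close> inherits minimality from \<open>x\<close> by transitivity.\<close>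
    with min \<open>y \<in> E\<close> have "is_arg_min (\<lambda>y. \<Sum>i<d. w i * J i y) (\<lambda>y. y \<in> E) y"
      unfolding is_arg_min_linorder by (meson order_trans)
    then have "y = x"
      by (rule unique)
    with less show False
      by simp
  qed
  with min show ?thesis
    by (auto simp: pareto_optimal_def is_arg_min_def)
qed

theorem theorem5p3:
  fixes a b :: real
    and d r :: nat
    and \<alpha> \<beta> \<gamma> ya yb :: "real^'n"
    and L G :: "nat \<Rightarrow> real \<times> (real^'n) \<times> (real^'n) \<Rightarrow> real"
    and w :: "nat \<Rightarrow> real"
  defines "E \<equiv> admissible a b \<alpha> \<beta> \<gamma> r G ya yb"
    and "J \<equiv> \<lambda>i. functional (L i) a b \<alpha> \<beta> \<gamma>"
  defines "weighted \<equiv> \<lambda>y. \<Sum>i<d. w i * J i y"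
  assumes "a < b" and "1 \<le> d" and "r < CARD('n)"
    and "\<And>i. 0 < \<alpha> $ i \<and> \<alpha> $ i < 1"
    and "\<And>i. 0 < \<beta> $ i \<and> \<beta> $ i < 1"
    and "\<And>i. 0 \<le> \<gamma> $ i \<and> \<gamma> $ i \<le> 1"
    and "\<And>i. i < d \<Longrightarrow> C1_on ({a..b} \<times> UNIV) (L i)"
    and "\<And>j. j < r \<Longrightarrow> C1_on ({a..b} \<times> UNIV) (G j)"
    and "independent_constraints a b r G"
    and "\<And>i. i < d \<Longrightarrow> 0 \<le> w i"
    and "(\<Sum>i<d. w i) = 1"
  shows "((\<forall>i<d. 0 < w i) \<longrightarrow>
           (\<forall>y. is_arg_min weighted (\<lambda>y. y \<in> E) y \<longrightarrow> pareto_optimal E d J y)) \<and>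
         (\<forall>y. is_arg_min weighted (\<lambda>y. y \<in> E) y \<and>
             (\<forall>z. is_arg_min weighted (\<lambda>y. y \<in> E) z \<longrightarrow> z = y) \<longrightarrow> pareto_optimal E d J y)"
  \<comment> \<open>\<open>assms(13)\<close> is the nonnegativity of the weights, counting the three
    \<open>defines\<close> equations first.\<close>
  using weighted_sum_arg_min_pareto_optimal[of d w J E]
    weighted_sum_unique_arg_min_pareto_optimal[of d w J E] assms(13)
  unfolding weighted_def by blast

end
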